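(* Let $V^h$, $(\cdot,\cdot)$, $\|\cdot\|$, $A$, $\delta>0$ be as in the context, so that $A=A^*\ge\delta I$ on $V^h$. Let $T>0$, $\phi,\psi\in V^h$, and let $\omega:[0,T]\to\mathbb{R}$ be a continuous function with $\omega(t)\ge 0$ and $\int_0^T\omega(t)\,dt=1$. Let $w:[0,T]\to V^h$ and $\varphi\in V^h$ be the solution of the inverse problem $$\frac{dw}{dt}+Aw=\varphi,\quad 0<t\le T,\qquad w(0)=\phi,\qquad \int_0^T\omega(t)w(t)\,dt=\psi .$$ Given an arbitrary $\varphi^0\in V^h$, define iterates for $k=0,1,\dots$ as follows: given $\varphi^k$, the function $w^k:[0,T]\to V^h$ is the solution of $$\frac{dw^{k}}{dt}+Aw^{k}=\varphi^{k},\quad 0<t\le T,\qquad w^{k}(0)=\phi,$$ and $$\varphi^{k+1}=\int_0^T\omega(t)\frac{dw^{k}}{dt}(t)\,dt+A\psi .$$ Then the iterative process converges linearly with speed $$\varrho=\int_0^T\omega(t)\exp(-\delta t)\,dt,$$ and for all $k=0,1,\dots$ the following estimate holds: $$\|\varphi^{k+1}-\varphi\|\le\varrho\,\|\varphi^{k}-\varphi\|.$$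
   Context: Let $\Omega\subset\mathbb{R}^2$ be a bounded polygon, $(u,v)=\int_\Omega uv\,d\boldsymbol{x}$ and $\|u\|=(u,u)^{1/2}$ the $L_2(\Omega)$ scalar product and norm. Let $k,c$ be functions on $\Omega$ with $0<k_1\le k(\boldsymbol{x})\le k_2$, $c(\boldsymbol{x})\ge 0$, and $\mu$ a function on $\partial\Omega$ with $\mu(\boldsymbol{x})\ge\mu_1>0$, and let $$a(u,v)=\int_\Omega\left(k\,\mathrm{grad}\,u\cdot\mathrm{grad}\,v+c\,uv\right)d\boldsymbol{x}+\int_{\partial\Omega}\mu\,uv\,d\boldsymbol{x}$$ (assumed well defined). $V^h\subset H^1(\Omega)$ is a finite-dimensional (finite element) subspace with the $L_2(\Omega)$ scalar product, and $A:V^h\to V^h$ is defined by $(Ay,v)=a(y,v)$ for all $y,v\in V^h$. Here $\delta>0$ is a constant with $a(u,u)\ge\delta\|u\|^2$, so $A=A^*\ge\delta I$ on $V^h$, where $I$ is the identity operator. The inverse problem is assumed to be well-posed. *)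

theory Defs
  imports "HOL-Analysis.Analysis"
begin

type_synonym plane = "real^2"

definition square_integrable :: "(plane \<Rightarrow> real) \<Rightarrow> bool" where
  "square_integrable f \<longleftrightarrow>
     f \<in> borel_measurable lebesgue \<and> integrable lebesgue (\<lambda>x. (f x)\<^sup>2)"

definition L2_equiv :: "(plane \<Rightarrow> real) \<Rightarrow> (plane \<Rightarrow> real) \<Rightarrow> bool" where
  "L2_equiv f g \<longleftrightarrow>
     square_integrable f \<and> square_integrable g \<and> (AE x in lebesgue. f x = g x)"

lemma square_integrable_zero: "square_integrable (\<lambda>_. 0)"
  by (simp add: square_integrable_def)

lemma square_integrable_mult:
  assumes "square_integrable f" "square_integrable g"
  shows "integrable lebesgue (\<lambda>x. f x * g x)"
proof (rule Bochner_Integration.integrable_bound)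
  show "integrable lebesgue (\<lambda>x. (f x)\<^sup>2 + (g x)\<^sup>2)"
    using assms by (simp add: square_integrable_def)
  show "(\<lambda>x. f x * g x) \<in> borel_measurable lebesgue"
    using assms by (intro borel_measurable_times) (auto simp: square_integrable_def)
  have "\<bar>a * b\<bar> \<le> a\<^sup>2 + b\<^sup>2" for a b :: real
  proof -
    have "2 * (\<bar>a\<bar> * \<bar>b\<bar>) \<le> \<bar>a\<bar>\<^sup>2 + \<bar>b\<bar>\<^sup>2"
      using sum_squares_bound[of "\<bar>a\<bar>" "\<bar>b\<bar>"] by (simp add: mult.assoc)
    moreover have "0 \<le> \<bar>a\<bar> * \<bar>b\<bar>" by simp
    ultimately have "\<bar>a\<bar> * \<bar>b\<bar> \<le> \<bar>a\<bar>\<^sup>2 + \<bar>b\<bar>\<^sup>2" by linarith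
    then show ?thesis by (simp add: abs_mult)
  qed
  then show "AE x in lebesgue. norm (f x * g x) \<le> norm ((f x)\<^sup>2 + (g x)\<^sup>2)"
    by simp
qed

lemma square_integrable_add:
  assumes "square_integrable f" "square_integrable g"
  shows "square_integrable (\<lambda>x. f x + g x)"
proof -
  have "integrable lebesgue (\<lambda>x. (f x)\<^sup>2 + (g x)\<^sup>2 + 2 * (f x * g x))"
    using assms square_integrable_mult[OF assms] by (simp add: square_integrable_def)
  then show ?thesis
    using assms by (auto simp: square_integrable_def power2_sum mult.assoc intro!: borel_measurable_add)
qed

lemma square_integrable_cmult:
  "square_integrable f \<Longrightarrow> square_integrable (\<lambda>x. r * f x)"
  by (auto simp: square_integrable_def power_mult_distrib intro!: borel_measurable_times)

lemma square_integrable_uminus: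
  "square_integrable f \<Longrightarrow> square_integrable (\<lambda>x. - f x)"
  using square_integrable_cmult[of f "-1"] by simp

lemma square_integrable_diff:
  "square_integrable f \<Longrightarrow> square_integrable g \<Longrightarrow> square_integrable (\<lambda>x. f x - g x)"
  using square_integrable_add[of f "\<lambda>x. - g x"] square_integrable_uminus[of g] by simp

lemma part_equivp_L2_equiv: "part_equivp L2_equiv"
proof (rule part_equivpI)
  show "\<exists>f. L2_equiv f f"
    using square_integrable_zero by (auto simp: L2_equiv_def)
  show "symp L2_equiv"
    by (auto simp: symp_def L2_equiv_def elim: eventually_mono)
  show "transp L2_equiv"
    by (auto simp: transp_def L2_equiv_def)
qed

quotient_type L2 = "plane \<Rightarrow> real" / partial: L2_equiv
  by (rule part_equivp_L2_equiv)

instantiation L2 :: real_inner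
begin

lift_definition zero_L2 :: L2 is "\<lambda>_. 0"
  by (simp add: L2_equiv_def square_integrable_zero)

lift_definition plus_L2 :: "L2 \<Rightarrow> L2 \<Rightarrow> L2" is "\<lambda>f g x. f x + g x"
  by (auto simp: L2_equiv_def square_integrable_add)

lift_definition uminus_L2 :: "L2 \<Rightarrow> L2" is "\<lambda>f x. - f x"
  by (auto simp: L2_equiv_def square_integrable_uminus)

lift_definition minus_L2 :: "L2 \<Rightarrow> L2 \<Rightarrow> L2" is "\<lambda>f g x. f x - g x"
  by (auto simp: L2_equiv_def square_integrable_diff)

lift_definition scaleR_L2 :: "real \<Rightarrow> L2 \<Rightarrow> L2" is "\<lambda>r f x. r * f x"
  by (auto simp: L2_equiv_def square_integrable_cmult)

lift_definition inner_L2 :: "L2 \<Rightarrow> L2 \<Rightarrow> real" is "\<lambda>f g. \<integral>x. f x * g x \<partial>lebesgue"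
  by (intro integral_cong_AE borel_measurable_times) (auto simp: L2_equiv_def square_integrable_def)

definition norm_L2 :: "L2 \<Rightarrow> real" where
  "norm_L2 u = sqrt (inner u u)"

definition sgn_L2 :: "L2 \<Rightarrow> L2" where
  "sgn_L2 u = inverse (norm u) *\<^sub>R u"

definition dist_L2 :: "L2 \<Rightarrow> L2 \<Rightarrow> real" where
  "dist_L2 u v = norm (u - v)"

definition uniformity_L2 :: "(L2 \<times> L2) filter" where
  "uniformity_L2 = (INF e\<in>{0<..}. principal {(u, v). dist u v < e})"

definition open_L2 :: "L2 set \<Rightarrow> bool" where
  "open_L2 U \<longleftrightarrow> (\<forall>u\<in>U. \<forall>\<^sub>F (u', v) in uniformity. u' = u \<longrightarrow> v \<in> U)"

instance
proof
  fix u v w :: L2 and r s :: real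
  show "u + v + w = u + (v + w)"
    by transfer (auto simp: L2_equiv_def square_integrable_add)
  show "u + v = v + u"
    by transfer (auto simp: L2_equiv_def square_integrable_add add.commute)
  show "0 + u = u"
    by transfer (auto simp: L2_equiv_def)
  show "- u + u = 0"
    by transfer (auto simp: L2_equiv_def square_integrable_zero)
  show "u - v = u + - v"
    by transfer (auto simp: L2_equiv_def square_integrable_diff)
  show "r *\<^sub>R (u + v) = r *\<^sub>R u + r *\<^sub>R v"
    by transfer (auto simp: L2_equiv_def square_integrable_add square_integrable_cmult algebra_simps)
  show "(r + s) *\<^sub>R u = r *\<^sub>R u + s *\<^sub>R u"
    by transfer (auto simp: L2_equiv_def square_integrable_add square_integrable_cmult algebra_simps)
  show "r *\<^sub>R s *\<^sub>R u = (r * s) *\<^sub>R u"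
    by transfer (auto simp: L2_equiv_def square_integrable_cmult algebra_simps)
  show "1 *\<^sub>R u = u"
    by transfer (auto simp: L2_equiv_def)
  show "dist u v = norm (u - v)" by (rule dist_L2_def)
  show "sgn u = inverse (norm u) *\<^sub>R u" by (rule sgn_L2_def)
  show "uniformity = (INF e\<in>{0<..}. principal {(u :: L2, v). dist u v < e})"
    by (rule uniformity_L2_def)
  show "open U \<longleftrightarrow> (\<forall>u\<in>U. \<forall>\<^sub>F (u', v) in uniformity. u' = u \<longrightarrow> v \<in> U)" for U :: "L2 set"
    by (rule open_L2_def)
  show "inner u v = inner v u"
    by transfer (simp add: mult.commute)
  show "inner (u + v) w = inner u w + inner v w"
    by transfer (simp add: L2_equiv_def distrib_right square_integrable_mult)
  show "inner (r *\<^sub>R u) v = r * inner u v"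
    by transfer (simp add: mult.assoc)
  show "0 \<le> inner u u"
    by transfer simp
  show "inner u u = 0 \<longleftrightarrow> u = 0"
  proof transfer
    fix f assume "L2_equiv f f"
    then have f: "square_integrable f" by (simp add: L2_equiv_def)
    have "(\<integral>x. f x * f x \<partial>lebesgue) = 0 \<longleftrightarrow> (AE x in lebesgue. f x * f x = 0)"
      using square_integrable_mult[OF f f] by (intro integral_nonneg_eq_0_iff_AE) auto
    then show "(\<integral>x. f x * f x \<partial>lebesgue) = 0 \<longleftrightarrow> L2_equiv f (\<lambda>_. 0)"
      using f square_integrable_zero by (simp add: L2_equiv_def)
  qed
  show "norm u = sqrt (inner u u)" by (rule norm_L2_def)
qed

end

text \<open>Square integrable functions on \<open>\<Omega>\<close> are identified with their extensions by zero.
  \<^const>\<open>rep_L2\<close> picks a representative, unique up to a null set.\<close>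

definition L2_on :: "plane set \<Rightarrow> L2 set" where
  "L2_on \<Omega> = {u. AE x in lebesgue. x \<notin> \<Omega> \<longrightarrow> rep_L2 u x = 0}"

coinductive smooth :: "(plane \<Rightarrow> real) \<Rightarrow> bool" where
  "\<lbrakk>\<And>x. f differentiable at x; \<And>e. smooth (\<lambda>x. frechet_derivative f (at x) e)\<rbrakk> \<Longrightarrow> smooth f"

definition test_function :: "plane set \<Rightarrow> (plane \<Rightarrow> real) \<Rightarrow> bool" where
  "test_function \<Omega> \<theta> \<longleftrightarrow>
     smooth \<theta> \<and> (\<exists>K. compact K \<and> K \<subseteq> \<Omega> \<and> (\<forall>x. x \<notin> K \<longrightarrow> \<theta> x = 0))"

definition is_weak_deriv :: "plane set \<Rightarrow> plane \<Rightarrow> L2 \<Rightarrow> L2 \<Rightarrow> bool" where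
  "is_weak_deriv \<Omega> e u g \<longleftrightarrow> g \<in> L2_on \<Omega> \<and>
     (\<forall>\<theta>. test_function \<Omega> \<theta> \<longrightarrow>
        (LINT x:\<Omega>|lebesgue. rep_L2 u x * frechet_derivative \<theta> (at x) e) =
        - (LINT x:\<Omega>|lebesgue. rep_L2 g x * \<theta> x))"

definition H1 :: "plane set \<Rightarrow> L2 set" where
  "H1 \<Omega> = {u \<in> L2_on \<Omega>. \<forall>e\<in>Basis. \<exists>g. is_weak_deriv \<Omega> e u g}"

definition weak_deriv :: "plane set \<Rightarrow> plane \<Rightarrow> L2 \<Rightarrow> L2" where
  "weak_deriv \<Omega> e u = (THE g. is_weak_deriv \<Omega> e u g)"

definition weak_grad :: "plane set \<Rightarrow> L2 \<Rightarrow> plane \<Rightarrow> plane" where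
  "weak_grad \<Omega> u x = (\<Sum>e\<in>Basis. rep_L2 (weak_deriv \<Omega> e u) x *\<^sub>R e)"

fun polygonal_path :: "plane list \<Rightarrow> real \<Rightarrow> plane" where
  "polygonal_path [] = linepath 0 0"
| "polygonal_path [a] = linepath a a"
| "polygonal_path [a, b] = linepath a b"
| "polygonal_path (a # b # c # vs) = linepath a b +++ polygonal_path (b # c # vs)"

text \<open>The closed polygonal curve through the vertices \<open>vs\<close>, returning to the first of them.\<close>

definition polygon_boundary :: "plane list \<Rightarrow> real \<Rightarrow> plane" where
  "polygon_boundary vs = polygonal_path (vs @ [hd vs])"

definition is_polygon :: "plane list \<Rightarrow> plane set \<Rightarrow> bool" where
  "is_polygon vs \<Omega> \<longleftrightarrow> vs \<noteq> [] \<and> simple_path (polygon_boundary vs) \<and>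
     \<Omega> = inside (path_image (polygon_boundary vs))"

text \<open>Integration with respect to arc length along a piecewise linear curve
  (the derivative is only missing at finitely many parameters).\<close>

definition arc_integrable :: "(real \<Rightarrow> plane) \<Rightarrow> (plane \<Rightarrow> real) \<Rightarrow> bool" where
  "arc_integrable p f \<longleftrightarrow>
     set_integrable lebesgue {0..1} (\<lambda>t. f (p t) * norm (vector_derivative p (at t)))"

definition arc_integral :: "(real \<Rightarrow> plane) \<Rightarrow> (plane \<Rightarrow> real) \<Rightarrow> real" where
  "arc_integral p f =
     (LINT t:{0..1}|lebesgue. f (p t) * norm (vector_derivative p (at t)))"

definition arc_measurable :: "(real \<Rightarrow> plane) \<Rightarrow> (plane \<Rightarrow> real) \<Rightarrow> bool" where
  "arc_measurable p f \<longleftrightarrow> (\<lambda>t. f (p t)) \<in> borel_measurable (lebesgue_on {0..1})"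

definition restrict_L2 :: "plane set \<Rightarrow> (plane \<Rightarrow> real) \<Rightarrow> L2" where
  "restrict_L2 \<Omega> f = abs_L2 (\<lambda>x. indicat_real \<Omega> x * f x)"

text \<open>The trace of \<open>u\<close> is the limit in \<open>L\<^sub>2\<close> of the boundary curve of the boundary values of
  smooth functions that converge to \<open>u\<close> in the norm of \<^term>\<open>H1 \<Omega>\<close>. It is determined
  up to null sets of the boundary.\<close>

definition is_trace :: "plane list \<Rightarrow> plane set \<Rightarrow> L2 \<Rightarrow> (plane \<Rightarrow> real) \<Rightarrow> bool" where
  "is_trace vs \<Omega> u g \<longleftrightarrow>
     arc_measurable (polygon_boundary vs) g \<and>
     arc_integrable (polygon_boundary vs) (\<lambda>x. (g x)\<^sup>2) \<and>
     (\<exists>f :: nat \<Rightarrow> plane \<Rightarrow> real.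
        (\<forall>n. smooth (f n)) \<and>
        (\<lambda>n. restrict_L2 \<Omega> (f n)) \<longlonglongrightarrow> u \<and>
        (\<forall>e\<in>Basis. (\<lambda>n. restrict_L2 \<Omega> (\<lambda>x. frechet_derivative (f n) (at x) e))
            \<longlonglongrightarrow> weak_deriv \<Omega> e u) \<and>
        (\<lambda>n. arc_integral (polygon_boundary vs) (\<lambda>x. (f n x - g x)\<^sup>2)) \<longlonglongrightarrow> 0)"

definition boundary_trace :: "plane list \<Rightarrow> plane set \<Rightarrow> L2 \<Rightarrow> plane \<Rightarrow> real" where
  "boundary_trace vs \<Omega> u = (SOME g. is_trace vs \<Omega> u g)"

definition form_integrable ::
  "plane list \<Rightarrow> plane set \<Rightarrow> (plane \<Rightarrow> real) \<Rightarrow> (plane \<Rightarrow> real) \<Rightarrow> (plane \<Rightarrow> real) \<Rightarrow>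
   L2 \<Rightarrow> L2 \<Rightarrow> bool" where
  "form_integrable vs \<Omega> k c \<mu> u v \<longleftrightarrow>
     set_integrable lebesgue \<Omega> (\<lambda>x. k x * (weak_grad \<Omega> u x \<bullet> weak_grad \<Omega> v x)
        + c x * rep_L2 u x * rep_L2 v x) \<and>
     arc_integrable (polygon_boundary vs) (\<lambda>x. \<mu> x * boundary_trace vs \<Omega> u x * boundary_trace vs \<Omega> v x)"

definition energy_form ::
  "plane list \<Rightarrow> plane set \<Rightarrow> (plane \<Rightarrow> real) \<Rightarrow> (plane \<Rightarrow> real) \<Rightarrow> (plane \<Rightarrow> real) \<Rightarrow>
   L2 \<Rightarrow> L2 \<Rightarrow> real" where
  "energy_form vs \<Omega> k c \<mu> u v =
     (LINT x:\<Omega>|lebesgue. k x * (weak_grad \<Omega> u x \<bullet> weak_grad \<Omega> v x)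
        + c x * rep_L2 u x * rep_L2 v x) +
     arc_integral (polygon_boundary vs) (\<lambda>x. \<mu> x * boundary_trace vs \<Omega> u x * boundary_trace vs \<Omega> v x)"

definition time_deriv :: "real \<Rightarrow> (real \<Rightarrow> L2) \<Rightarrow> real \<Rightarrow> L2" where
  "time_deriv T w t = vector_derivative w (at t within {0..T})"

text \<open>\<open>w\<close> solves \<open>dw/dt + A w = f\<close> for \<open>0 < t \<le> T\<close> with \<open>w(0) = w\<^sub>0\<close>, where \<open>f\<close> does not
  depend on time.\<close>

definition solves_cauchy ::
  "L2 set \<Rightarrow> (L2 \<Rightarrow> L2) \<Rightarrow> real \<Rightarrow> L2 \<Rightarrow> L2 \<Rightarrow> (real \<Rightarrow> L2) \<Rightarrow> bool" where
  "solves_cauchy V A T f w0 w \<longleftrightarrow>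
     (\<forall>t\<in>{0..T}. w t \<in> V) \<and> continuous_on {0..T} w \<and>
     (\<forall>t\<in>{0<..T}. w differentiable (at t within {0..T}) \<and> time_deriv T w t + A (w t) = f) \<and>
     w 0 = w0"

end

theory Submission
  imports Defs
begin

text \<open>The operator \<open>A\<close> is linear on \<open>V\<close>: it represents the symmetric form \<^const>\<open>energy_form\<close>,
  and the inner product is linear in its second argument. The error \<open>\<phi>it (Suc n) - \<phi>s\<close> is the
  integral of \<open>\<omega> t *\<^sub>R q t\<close>, where \<open>z = wit n - w\<close> and \<open>q = z' = (\<phi>it n - \<phi>s) - A z\<close>.
  Since \<open>q' = - A q\<close> and \<open>A\<close> is coercive, \<open>exp (\<delta> t) * norm (q t)\<close> is nonincreasing.\<close>

section \<open>Linear algebra and integration in a finite-dimensional subspace\<close>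

text \<open>Both sides are linear in \<open>u\<close>, so it is enough to compare them on an
  orthogonal spanning set \<open>D\<close>, where only the term of \<open>sgn d\<close> survives. A
  zero vector in \<open>D\<close> does no harm: \<open>sgn 0 = 0\<close> contributes nothing to the
  sum.\<close>

lemma orthonormal_expansion:
  fixes B :: "'a::real_inner set"
  assumes "finite B"
  obtains C where "finite C" "C \<subseteq> span B" "\<And>u. u \<in> span B \<Longrightarrow> u = (\<Sum>b\<in>C. (u \<bullet> b) *\<^sub>R b)"
proof -
  obtain D where D: "finite D" "span D = span B" "pairwise orthogonal D"
    using basis_orthogonal[OF assms] by metis
  define C where "C = sgn ` D"
  have "finite C"
    using D by (simp add: C_def)
  moreover have C_sub: "C \<subseteq> span B"
    using D(2) by (auto simp: C_def sgn_div_norm D(2)[symmetric] intro: span_scale span_base)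
  moreover have "u = (\<Sum>b\<in>C. (u \<bullet> b) *\<^sub>R b)" if "u \<in> span B" for u
  proof -
    have "u \<in> span D" using that D by simp
    then show ?thesis
    proof (induction rule: span_induct_alt)
      case base
      show ?case by simp
    next
      case (step r d v)
      have other: "d \<bullet> b = 0" if b: "b \<in> C" "b \<noteq> sgn d" for b
      proof -
        obtain e where e: "e \<in> D" "b = sgn e" using b by (auto simp: C_def)
        with b have "e \<noteq> d" by auto
        then have "orthogonal d e" using D(3) e step by (auto simp: pairwise_def)
        then show ?thesis using e by (simp add: sgn_div_norm orthogonal_def)
      qed
      have "(\<Sum>b\<in>C. (d \<bullet> b) *\<^sub>R b) = (\<Sum>b\<in>{sgn d}. (d \<bullet> b) *\<^sub>R b)"
        using \<open>finite C\<close> step other by (intro sum.mono_neutral_right) (auto simp: C_def)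
      also have "\<dots> = d"
        by (cases "d = 0") (simp_all add: sgn_div_norm dot_square_norm power2_eq_square field_simps)
      finally have d: "(\<Sum>b\<in>C. (d \<bullet> b) *\<^sub>R b) = d" .
      have "(\<Sum>b\<in>C. ((r *\<^sub>R d + v) \<bullet> b) *\<^sub>R b) =
          r *\<^sub>R (\<Sum>b\<in>C. (d \<bullet> b) *\<^sub>R b) + (\<Sum>b\<in>C. (v \<bullet> b) *\<^sub>R b)"
        by (simp add: inner_add_left scaleR_add_left sum.distrib scaleR_sum_right)
      then show ?case using d step.IH by simp
    qed
  qed
  ultimately show ?thesis by (rule that)
qed

text \<open>The coordinates \<open>u \<bullet> b\<close> make sense for every \<open>u\<close>, so
  composing \<open>A\<close> with the orthogonal projection onto the span gives an operator on the
  whole space. An operator known only on a subspace thereby becomes a \<open>bounded_linear\<close>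
  one, to which the rules for continuity, derivatives and integrals apply.\<close>

lemma linear_on_finite_span_extends:
  fixes A :: "'a::real_inner \<Rightarrow> 'b::real_normed_vector"
  assumes "finite B"
    and add: "\<And>x y. x \<in> span B \<Longrightarrow> y \<in> span B \<Longrightarrow> A (x + y) = A x + A y"
    and scale: "\<And>r x. x \<in> span B \<Longrightarrow> A (r *\<^sub>R x) = r *\<^sub>R A x"
  obtains L where "bounded_linear L" "\<And>x. x \<in> span B \<Longrightarrow> L x = A x"
proof -
  obtain C where C: "finite C" "C \<subseteq> span B"
    and expand: "\<And>u. u \<in> span B \<Longrightarrow> u = (\<Sum>b\<in>C. (u \<bullet> b) *\<^sub>R b)"
    using orthonormal_expansion[OF \<open>finite B\<close>] by metis
  define L where "L u = (\<Sum>b\<in>C. (u \<bullet> b) *\<^sub>R A b)" for u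
  have sum: "A (\<Sum>b\<in>F. g b *\<^sub>R b) = (\<Sum>b\<in>F. g b *\<^sub>R A b)" if "F \<subseteq> C" for g F
  proof -
    have "finite F" using that C finite_subset by blast
    then show ?thesis using that
    proof (induction F)
      case empty
      show ?case using scale[of 0 0] by (simp add: span_zero)
    next
      case (insert b F)
      then have "b \<in> span B" using C by auto
      moreover have "(\<Sum>b\<in>F. g b *\<^sub>R b) \<in> span B"
        using insert C by (intro span_sum span_scale) auto
      ultimately show ?case using insert by (simp add: add scale span_scale)
    qed
  qed
  have "bounded_linear L"
    unfolding L_def
    by (intro bounded_linear_sum bounded_linear_compose[OF bounded_linear_scaleR_left]
        bounded_linear_inner_left)
  moreover have "L x = A x" if "x \<in> span B" for x
    using sum[of C "\<lambda>b. x \<bullet> b"] expand[OF that] by (simp add: L_def)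
  ultimately show ?thesis by (rule that)
qed

text \<open>The value space is not assumed to be complete, so integrability has to be obtained
  componentwise.\<close>

lemma integral_in_finite_span:
  fixes f :: "real \<Rightarrow> 'a::real_inner"
  assumes "finite B" "continuous_on {a..b} f" "\<And>t. t \<in> {a..b} \<Longrightarrow> f t \<in> span B"
  shows "f integrable_on {a..b}" "integral {a..b} f \<in> span B"
proof -
  obtain C where C: "finite C" "C \<subseteq> span B"
    and expand: "\<And>u. u \<in> span B \<Longrightarrow> u = (\<Sum>b\<in>C. (u \<bullet> b) *\<^sub>R b)"
    using orthonormal_expansion[OF \<open>finite B\<close>] by metis
  have "((\<lambda>t. \<Sum>e\<in>C. (f t \<bullet> e) *\<^sub>R e) has_integral
      (\<Sum>e\<in>C. integral {a..b} (\<lambda>t. f t \<bullet> e) *\<^sub>R e)) {a..b}"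
    using assms(2) C(1)
    by (intro has_integral_sum has_integral_scaleR_left integrable_integral
        integrable_continuous_real continuous_intros)
  then have I: "(f has_integral (\<Sum>e\<in>C. integral {a..b} (\<lambda>t. f t \<bullet> e) *\<^sub>R e)) {a..b}"
    by (rule has_integral_eq[rotated]) (use expand assms(3) in metis)
  then show "f integrable_on {a..b}" by blast
  have "(\<Sum>e\<in>C. integral {a..b} (\<lambda>t. f t \<bullet> e) *\<^sub>R e) \<in> span B"
    using C by (intro span_sum span_scale) auto
  then show "integral {a..b} f \<in> span B"
    using I by (simp add: integral_unique)
qed

text \<open>Testing the integral against its own value \<open>I\<close> leaves real integrals only:
  Cauchy-Schwarz bounds \<open>I \<bullet> I\<close> by \<open>J * norm I\<close>, and
  \<open>norm I\<close> cancels unless it is zero.\<close>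

lemma norm_has_integral_bound:
  fixes f :: "real \<Rightarrow> 'a::real_inner"
  assumes f: "(f has_integral I) {a..b}" and g: "(g has_integral J) {a..b}"
    and le: "\<And>t. t \<in> {a..b} \<Longrightarrow> norm (f t) \<le> g t"
  shows "norm I \<le> J"
proof (cases "I = 0")
  case True
  have "0 \<le> J"
    using le by (intro has_integral_nonneg[OF g]) (meson norm_ge_zero order_trans)
  with True show ?thesis by simp
next
  case False
  have "((\<lambda>t. f t \<bullet> I) has_integral (I \<bullet> I)) {a..b}"
    using has_integral_linear[OF f bounded_linear_inner_left] by (simp add: o_def)
  moreover have "((\<lambda>t. g t * norm I) has_integral (J * norm I)) {a..b}"
    by (rule has_integral_mult_left[OF g])
  ultimately have "I \<bullet> I \<le> J * norm I"
  proof (rule has_integral_le)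
    fix t assume "t \<in> {a..b}"
    have "f t \<bullet> I \<le> norm (f t) * norm I" by (rule norm_cauchy_schwarz)
    also have "\<dots> \<le> g t * norm I" using le[OF \<open>t \<in> {a..b}\<close>] by (rule mult_right_mono) simp
    finally show "f t \<bullet> I \<le> g t * norm I" .
  qed
  with False show ?thesis by (simp add: dot_square_norm power2_eq_square)
qed

section \<open>Exponential decay of the residual\<close>

text \<open>The residual \<open>q = f - L z\<close> starts at \<open>f\<close> because
  \<open>z 0 = 0\<close>, and an energy estimate controls it from there. Coercivity is demanded
  along the residual alone, since in the application it is known on \<open>V\<close> and not for
  \<open>L\<close> on the whole space.\<close>

lemma coercive_flow_decay:
  fixes z :: "real \<Rightarrow> 'a::real_inner"
  assumes L: "bounded_linear L"
    and z_cont: "continuous_on {0..T} z" and "z 0 = 0"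
    and z_deriv: "\<And>t. 0 < t \<Longrightarrow> t < T \<Longrightarrow> (z has_vector_derivative (f - L (z t))) (at t)"
    and coercive: "\<And>t. t \<in> {0..T} \<Longrightarrow>
      \<delta> * (norm (f - L (z t)))\<^sup>2 \<le> L (f - L (z t)) \<bullet> (f - L (z t))"
    and t: "t \<in> {0..T}"
  shows "norm (f - L (z t)) \<le> exp (- \<delta> * t) * norm f"
proof -
  interpret L: bounded_linear L by (rule L)
  define q where "q = (\<lambda>s. f - L (z s))"
  define g where "g s = exp (2 * \<delta> * s) * (q s \<bullet> q s)" for s
  have q_cont: "continuous_on {0..T} q"
    unfolding q_def by (intro continuous_intros L.continuous_on z_cont)
  have q_deriv: "(q has_vector_derivative - L (q s)) (at s)" if "0 < s" "s < T" for s
    unfolding q_def using z_deriv[OF that]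
    by (auto intro!: derivative_eq_intros L.has_vector_derivative)
  \<comment> \<open>Continuity on the closed interval and a derivative in its interior suffice for
    monotonicity, so nothing is asked about derivatives at the endpoints. The factor 2 in the
    exponent of \<open>g\<close> matches the square of the norm and makes the coercivity defect
    appear in \<open>?D\<close>.\<close>
  have "g t \<le> g 0"
  proof (rule DERIV_nonpos_imp_decreasing_open[where f = g])
    show "0 \<le> t" using t by simp
    show "continuous_on {0..t} g"
      unfolding g_def using t
      by (intro continuous_intros continuous_on_subset[OF q_cont]) auto
    fix s assume s: "0 < s" "s < t"
    let ?D = "exp (2 * \<delta> * s) * (2 * (\<delta> * (q s \<bullet> q s) - L (q s) \<bullet> q s))"
    have "((\<lambda>s. q s \<bullet> q s) has_real_derivative - 2 * (L (q s) \<bullet> q s)) (at s)"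
      using has_derivative_inner[OF q_deriv[of s, unfolded has_vector_derivative_def]
          q_deriv[of s, unfolded has_vector_derivative_def]] s t
      by (auto simp: has_field_derivative_def inner_commute algebra_simps
          elim!: has_derivative_eq_rhs)
    then have "(g has_real_derivative ?D) (at s)"
      unfolding g_def by (auto intro!: derivative_eq_intros simp: algebra_simps)
    moreover have "?D \<le> 0"
      using coercive[of s] s t by (auto simp: q_def dot_square_norm mult_le_0_iff)
    ultimately show "\<exists>y. (g has_real_derivative y) (at s) \<and> y \<le> 0" by blast
  qed
  then have "(exp (\<delta> * t) * norm (q t))\<^sup>2 \<le> (norm f)\<^sup>2"
    using \<open>z 0 = 0\<close>
    by (simp add: g_def q_def L.zero dot_square_norm power_mult_distrib exp_double[symmetric] mult.assoc)
  then have "exp (\<delta> * t) * norm (q t) \<le> norm f"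
    by (rule power2_le_imp_le) simp
  then show ?thesis
    by (simp add: q_def exp_minus field_simps)
qed

section \<open>The contraction factor\<close>

text \<open>This is an average of \<open>exp (- \<delta> * t)\<close> with a weight of mass one. The
  exponential is at least its value at \<open>T\<close>, which gives positivity, and lies strictly
  below 1 for \<open>t > 0\<close>, which gives the strict upper bound.\<close>

lemma exp_weighted_mean_bounds:
  fixes \<omega> :: "real \<Rightarrow> real"
  assumes "0 < \<delta>" "0 < T" and cont: "continuous_on {0..T} \<omega>"
    and nonneg: "\<And>t. t \<in> {0..T} \<Longrightarrow> 0 \<le> \<omega> t" and one: "integral {0..T} \<omega> = 1"
  shows "0 < integral {0..T} (\<lambda>t. \<omega> t * exp (- \<delta> * t))"
    and "integral {0..T} (\<lambda>t. \<omega> t * exp (- \<delta> * t)) < 1"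
proof -
  let ?g = "\<lambda>t. \<omega> t * exp (- \<delta> * t)"
  have \<omega>_int: "\<omega> integrable_on {0..T}"
    by (intro integrable_continuous_real cont)
  have g_cont: "continuous_on {0..T} ?g"
    by (intro continuous_intros cont)
  have g_int: "?g integrable_on {0..T}"
    by (intro integrable_continuous_real g_cont)
  have "exp (- \<delta> * T) = integral {0..T} (\<lambda>t. \<omega> t * exp (- \<delta> * T))"
    using one by simp
  also have "\<dots> \<le> integral {0..T} ?g"
    using \<omega>_int g_int nonneg \<open>0 < \<delta>\<close>
    by (intro integral_le) (auto intro!: mult_left_mono)
  finally show "0 < integral {0..T} ?g"
    using exp_gt_zero[of "- \<delta> * T"] by linarith
  have le: "?g t \<le> \<omega> t" if "t \<in> {0..T}" for t
    using nonneg[OF that] that \<open>0 < \<delta>\<close> by (intro mult_left_le) auto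
  \<comment> \<open>With equality, the continuous nonnegative function
    \<open>\<omega> t - ?g t\<close> would have integral zero and hence vanish. This forces
    \<open>\<omega> t = 0\<close> wherever the exponential differs from 1, that is off
    \<open>t = 0\<close>, against the mass one.\<close>
  have "integral {0..T} ?g \<noteq> integral {0..T} \<omega>"
  proof
    assume eq: "integral {0..T} ?g = integral {0..T} \<omega>"
    have "integral {0..T} (\<lambda>t. \<omega> t - ?g t) = 0"
      using integral_diff[OF \<omega>_int g_int] eq by simp
    then have zero: "\<omega> t - ?g t = 0" if "t \<in> {0..T}" for t
      using integral_eq_0_iff[OF continuous_on_diff[OF cont g_cont] \<open>0 < T\<close>] le that by simp
    have "\<omega> t = 0" if "t \<in> {0..T} - {0}" for t
      using zero[of t] that \<open>0 < \<delta>\<close> by auto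
    then have "integral {0..T} \<omega> = integral {0..T} (\<lambda>_. 0)"
      by (intro integral_spike[of "{0}"]) auto
    with one show False by simp
  qed
  moreover have "integral {0..T} ?g \<le> integral {0..T} \<omega>"
    by (rule integral_le[OF g_int \<omega>_int le])
  ultimately show "integral {0..T} ?g < 1"
    using one by simp
qed

text \<open>Symmetry lets linearity of \<open>A\<close> be read off from the inner product, avoiding
  a proof that the form is additive. That would be awkward, as \<open>boundary_trace\<close> and
  \<open>rep_L2\<close> choose representatives.\<close>

lemma energy_form_commute: "energy_form vs \<Omega> k c \<mu> u v = energy_form vs \<Omega> k c \<mu> v u"
  by (simp add: energy_form_def inner_commute mult_ac)

lemma solves_cauchy_time_deriv:
  assumes "solves_cauchy V A T f w0 w" "t \<in> {0<..T}"
  shows "time_deriv T w t = f - A (w t)"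
    and "(w has_vector_derivative (f - A (w t))) (at t within {0..T})"
proof -
  show deriv: "time_deriv T w t = f - A (w t)"
    using assms by (simp add: solves_cauchy_def eq_diff_eq)
  have "(w has_vector_derivative time_deriv T w t) (at t within {0..T})"
    using assms by (simp add: solves_cauchy_def vector_derivative_works time_deriv_def)
  then show "(w has_vector_derivative (f - A (w t))) (at t within {0..T})"
    by (simp add: deriv)
qed

theorem theorem3:
  fixes vs :: "plane list" and \<Omega> :: "plane set"
    and k c \<mu> :: "plane \<Rightarrow> real" and k1 k2 \<mu>1 \<delta> T :: real
    and V :: "L2 set" and A :: "L2 \<Rightarrow> L2"
    and \<phi> \<psi> \<phi>s :: L2 and \<omega> :: "real \<Rightarrow> real" and w :: "real \<Rightarrow> L2"
    and \<phi>it :: "nat \<Rightarrow> L2" and wit :: "nat \<Rightarrow> real \<Rightarrow> L2"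
  defines "\<rho> \<equiv> integral {0..T} (\<lambda>t. \<omega> t * exp (- \<delta> * t))"
  assumes polygon: "is_polygon vs \<Omega>"
    and k_measurable: "k \<in> borel_measurable (lebesgue_on \<Omega>)"
    and k_bounds: "0 < k1" "\<And>x. x \<in> \<Omega> \<Longrightarrow> k1 \<le> k x \<and> k x \<le> k2"
    and c_measurable: "c \<in> borel_measurable (lebesgue_on \<Omega>)"
    and c_nonneg: "\<And>x. x \<in> \<Omega> \<Longrightarrow> 0 \<le> c x"
    and \<mu>_measurable: "arc_measurable (polygon_boundary vs) \<mu>"
    and \<mu>_bound: "0 < \<mu>1" "\<And>x. x \<in> frontier \<Omega> \<Longrightarrow> \<mu>1 \<le> \<mu> x"
    and V_subspace: "subspace V" "V \<subseteq> H1 \<Omega>"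
    and V_finite_dim: "\<exists>B. finite B \<and> V = span B"
    and a_well_defined: "\<And>u v. u \<in> V \<Longrightarrow> v \<in> V \<Longrightarrow> form_integrable vs \<Omega> k c \<mu> u v"
    and A_maps: "\<And>y. y \<in> V \<Longrightarrow> A y \<in> V"
    and A_def: "\<And>y v. y \<in> V \<Longrightarrow> v \<in> V \<Longrightarrow> A y \<bullet> v = energy_form vs \<Omega> k c \<mu> y v"
    and \<delta>_pos: "0 < \<delta>"
    and coercive: "\<And>u. u \<in> V \<Longrightarrow> energy_form vs \<Omega> k c \<mu> u u \<ge> \<delta> * (norm u)\<^sup>2"
    and T_pos: "0 < T"
    and data: "\<phi> \<in> V" "\<psi> \<in> V"
    and \<omega>_cont: "continuous_on {0..T} \<omega>"
    and \<omega>_nonneg: "\<And>t. t \<in> {0..T} \<Longrightarrow> 0 \<le> \<omega> t"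
    and \<omega>_integral: "integral {0..T} \<omega> = 1"
    and inverse_problem: "\<phi>s \<in> V" "solves_cauchy V A T \<phi>s \<phi> w"
      "integral {0..T} (\<lambda>t. \<omega> t *\<^sub>R w t) = \<psi>"
    and initial_guess: "\<phi>it 0 \<in> V"
    and iterate_solves: "\<And>n. solves_cauchy V A T (\<phi>it n) \<phi> (wit n)"
    and iterate_update: "\<And>n. \<phi>it (Suc n) =
      integral {0..T} (\<lambda>t. \<omega> t *\<^sub>R time_deriv T (wit n) t) + A \<psi>"
  shows "0 < \<rho> \<and> \<rho> < 1 \<and> \<phi>it \<longlonglongrightarrow> \<phi>s \<and>
    (\<forall>n. norm (\<phi>it (Suc n) - \<phi>s) \<le> \<rho> * norm (\<phi>it n - \<phi>s))"
proof -

  \<comment> \<open>Linearity of \<open>A\<close> on \<open>V\<close>\<close>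
  obtain B where B: "finite B" "V = span B"
    using V_finite_dim by blast
  have adjoint: "A y \<bullet> v = A v \<bullet> y" if "y \<in> V" "v \<in> V" for y v
    using that by (simp add: A_def energy_form_commute)
  have eqI: "x = y" if "x \<in> V" "y \<in> V" "\<And>v. v \<in> V \<Longrightarrow> x \<bullet> v = y \<bullet> v" for x y
  proof -
    have "(x - y) \<bullet> (x - y) = 0"
      using that(3)[of "x - y"] that(1,2) V_subspace(1)
      by (simp add: subspace_diff inner_diff_left)
    then show ?thesis by simp
  qed
  have add: "A (x + y) = A x + A y" if "x \<in> V" "y \<in> V" for x y
    using that V_subspace(1)
    by (intro eqI) (auto simp: A_maps subspace_add adjoint[of "_ + _"] inner_add adjoint[of x] adjoint[of y])
  have scale: "A (r *\<^sub>R x) = r *\<^sub>R A x" if "x \<in> V" for r x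
    using that V_subspace(1)
    by (intro eqI) (auto simp: A_maps subspace_scale adjoint[of "_ *\<^sub>R _"] adjoint[of x])
  obtain L where L: "bounded_linear L" and L_eq: "\<And>x. x \<in> V \<Longrightarrow> L x = A x"
    using linear_on_finite_span_extends[of B A, folded B(2), OF B(1) add scale] by metis
  interpret L: bounded_linear L by (rule L)

  have w_V: "w t \<in> V" if "t \<in> {0..T}" for t
    using inverse_problem that by (simp add: solves_cauchy_def)
  have w_cont: "continuous_on {0..T} w"
    using inverse_problem by (simp add: solves_cauchy_def)
  have wit_V: "wit n t \<in> V" if "t \<in> {0..T}" for n t
    using iterate_solves[of n] that by (simp add: solves_cauchy_def)
  have wit_cont: "continuous_on {0..T} (wit n)" for n
    using iterate_solves[of n] by (simp add: solves_cauchy_def)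

  \<comment> \<open>The error as a weighted integral of the residual\<close>
  have "(\<lambda>t. \<omega> t *\<^sub>R w t) integrable_on {0..T}"
    using B w_V V_subspace(1)
    by (intro integral_in_finite_span[of B] continuous_intros \<omega>_cont w_cont)
       (auto simp: subspace_scale)
  then have \<psi>: "((\<lambda>t. \<omega> t *\<^sub>R w t) has_integral \<psi>) {0..T}"
    using inverse_problem(3) by (simp add: has_integral_integral)
  \<comment> \<open>The overdetermination condition enters here: moving the operator under the
    integral expresses \<open>A \<psi>\<close> through the exact trajectory.\<close>
  have A\<psi>: "((\<lambda>t. \<omega> t *\<^sub>R L (w t)) has_integral A \<psi>) {0..T}"
    using has_integral_linear[OF \<psi> L] L_eq[OF data(2)] by (simp add: o_def L.scaleR)
  have \<omega>1: "(\<omega> has_integral 1) {0..T}"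
    using \<omega>_integral integrable_continuous_real[OF \<omega>_cont] by (simp add: has_integral_integral)

  \<comment> \<open>Membership of \<open>\<phi>it n\<close> in \<open>V\<close> is carried as a
    hypothesis and passed on to the next iterate, so that induction can discharge it
    afterwards.\<close>
  have error: "((\<lambda>t. \<omega> t *\<^sub>R (\<phi>it n - \<phi>s - L (wit n t - w t))) has_integral (\<phi>it (Suc n) - \<phi>s)) {0..T}"
    and mem: "\<phi>it (Suc n) \<in> V" if "\<phi>it n \<in> V" for n
  proof -
    let ?f = "\<lambda>t. \<omega> t *\<^sub>R (\<phi>it n - L (wit n t))"
    have f_V: "?f t \<in> V" if "t \<in> {0..T}" for t
      using \<open>\<phi>it n \<in> V\<close> that V_subspace(1)
      by (simp add: subspace_scale subspace_diff L_eq wit_V A_maps)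
    have f_cont: "continuous_on {0..T} ?f"
      by (intro continuous_intros \<omega>_cont L.continuous_on wit_cont)
    note f = integral_in_finite_span[OF B(1) f_cont f_V[unfolded B(2)], folded B(2)]
    \<comment> \<open>\<^const>\<open>solves_cauchy\<close> says nothing about the derivative at \<open>0\<close>, hence the spike there.\<close>
    have "integral {0..T} (\<lambda>t. \<omega> t *\<^sub>R time_deriv T (wit n) t) = integral {0..T} ?f"
      using solves_cauchy_time_deriv(1)[OF iterate_solves[of n]] wit_V[of _ n]
      by (intro integral_spike[of "{0}"]) (auto simp: L_eq)
    then have upd: "\<phi>it (Suc n) = integral {0..T} ?f + A \<psi>"
      using iterate_update[of n] by simp
    then show "\<phi>it (Suc n) \<in> V"
      using f(2) A_maps[OF data(2)] V_subspace(1) by (simp add: subspace_add)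
    \<comment> \<open>The mass one of \<open>\<omega>\<close> allows the constant
      \<open>\<phi>s\<close> to be written as an integral too, so the whole error sits under one
      integral sign.\<close>
    have "((\<lambda>t. ?f t + \<omega> t *\<^sub>R L (w t) - \<omega> t *\<^sub>R \<phi>s) has_integral (\<phi>it (Suc n) - 1 *\<^sub>R \<phi>s)) {0..T}"
      unfolding upd
      by (intro has_integral_diff has_integral_add integrable_integral f(1) A\<psi>
          has_integral_scaleR_left \<omega>1)
    then show "((\<lambda>t. \<omega> t *\<^sub>R (\<phi>it n - \<phi>s - L (wit n t - w t))) has_integral (\<phi>it (Suc n) - \<phi>s)) {0..T}"
      by (simp add: L.diff algebra_simps)
  qed
  have it_V: "\<phi>it n \<in> V" for n
    by (induction n) (simp_all add: initial_guess mem)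

  \<comment> \<open>Decay of the difference between iterate and exact residuals\<close>
  have decay: "norm (\<phi>it n - \<phi>s - L (wit n t - w t)) \<le> exp (- \<delta> * t) * norm (\<phi>it n - \<phi>s)"
    if t: "t \<in> {0..T}" for n t
  proof (rule coercive_flow_decay[OF L, where z = "\<lambda>t. wit n t - w t", OF _ _ _ _ t])
    show "continuous_on {0..T} (\<lambda>t. wit n t - w t)"
      by (intro continuous_intros wit_cont w_cont)
    show "wit n 0 - w 0 = 0"
      using iterate_solves[of n] inverse_problem by (simp add: solves_cauchy_def)
    show "((\<lambda>t. wit n t - w t) has_vector_derivative (\<phi>it n - \<phi>s - L (wit n s - w s))) (at s)"
      if s: "0 < s" "s < T" for s
    proof -
      have "(wit n has_vector_derivative (\<phi>it n - A (wit n s))) (at s)"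
        "(w has_vector_derivative (\<phi>s - A (w s))) (at s)"
        using solves_cauchy_time_deriv(2)[OF iterate_solves[of n], of s]
          solves_cauchy_time_deriv(2)[OF inverse_problem(2), of s] s
        by (simp_all add: at_within_Icc_at)
      then have "((\<lambda>t. wit n t - w t) has_vector_derivative
          (\<phi>it n - A (wit n s) - (\<phi>s - A (w s)))) (at s)"
        by (rule has_vector_derivative_diff)
      then show ?thesis
        using s w_V[of s] wit_V[of s n] by (simp add: L.diff L_eq algebra_simps)
    qed
    show "\<delta> * (norm (\<phi>it n - \<phi>s - L (wit n s - w s)))\<^sup>2 \<le>
        L (\<phi>it n - \<phi>s - L (wit n s - w s)) \<bullet> (\<phi>it n - \<phi>s - L (wit n s - w s))"
      if "s \<in> {0..T}" for s
    proof -
      \<comment> \<open>On \<open>V\<close> the extension \<open>L\<close> is \<open>A\<close>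
        itself, so the coercivity of the form is available for the residual.\<close>
      have "\<phi>it n - \<phi>s - L (wit n s - w s) \<in> V"
        using V_subspace(1) it_V w_V[OF that] wit_V[OF that] inverse_problem(1)
        by (simp add: subspace_diff L_eq A_maps)
      then show ?thesis using coercive by (simp add: L_eq A_def)
    qed
  qed

  \<comment> \<open>Contraction and convergence of the iterates\<close>
  have step: "norm (\<phi>it (Suc n) - \<phi>s) \<le> \<rho> * norm (\<phi>it n - \<phi>s)" for n
  proof (rule norm_has_integral_bound[OF error[OF it_V]])
    show "((\<lambda>t. \<omega> t * exp (- \<delta> * t) * norm (\<phi>it n - \<phi>s)) has_integral \<rho> * norm (\<phi>it n - \<phi>s)) {0..T}"
      unfolding \<rho>_def
      by (intro has_integral_mult_left integrable_integral integrable_continuous_real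
          continuous_intros \<omega>_cont)
    fix t assume "t \<in> {0..T}"
    then show "norm (\<omega> t *\<^sub>R (\<phi>it n - \<phi>s - L (wit n t - w t))) \<le> \<omega> t * exp (- \<delta> * t) * norm (\<phi>it n - \<phi>s)"
      using mult_left_mono[OF decay \<omega>_nonneg] \<omega>_nonneg by (simp add: mult.assoc)
  qed
  have \<rho>: "0 < \<rho>" "\<rho> < 1"
    unfolding \<rho>_def
    by (rule exp_weighted_mean_bounds[OF \<delta>_pos T_pos \<omega>_cont \<omega>_nonneg \<omega>_integral]; assumption)+
  have power: "norm (\<phi>it n - \<phi>s) \<le> \<rho> ^ n * norm (\<phi>it 0 - \<phi>s)" for n
  proof (induction n)
    case (Suc n)
    have "norm (\<phi>it (Suc n) - \<phi>s) \<le> \<rho> * norm (\<phi>it n - \<phi>s)" by (rule step)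
    also have "\<dots> \<le> \<rho> * (\<rho> ^ n * norm (\<phi>it 0 - \<phi>s))"
      using Suc \<rho> by (intro mult_left_mono) auto
    finally show ?case by (simp add: mult.assoc)
  qed simp
  have "(\<lambda>n. \<rho> ^ n * norm (\<phi>it 0 - \<phi>s)) \<longlonglongrightarrow> 0"
    using \<rho> by (intro tendsto_mult_left_zero LIMSEQ_power_zero) auto
  then have "(\<lambda>n. \<phi>it n - \<phi>s) \<longlonglongrightarrow> 0"
    by (rule Lim_null_comparison[rotated]) (simp add: power)
  then have "\<phi>it \<longlonglongrightarrow> \<phi>s"
    by (simp add: LIM_zero_iff)
  with \<rho> step show ?thesis by blast
qed

end
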